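(* Let $\mathbf{M}$ be a model category in which every cofibration is flat. Let $K\xrightarrow{f}X\xrightarrow{\tau}Y$ be morphisms in $\mathbf{M}$, with $\tau$ a weak equivalence of fibrant objects, and let $A\to K$ be an object of $\mathbf{M}(K)$. Then the natural map $$\operatorname{Def}_f(A)\to \operatorname{Def}_{\tau f}(A),\qquad (A\to X_A\to X)\mapsto (A\to X_A\to X\xrightarrow{\tau}Y),$$ is bijective.
   Context: Let $\mathbf{M}$ be a model category. For an object $A$, $\mathbf{M}_A$ denotes the undercategory of maps $A\to X$ with its induced model structure. Flatness: a morphism $A\to B$ in $\mathbf{M}$ is flat if the functor $-\amalg_A B\colon \mathbf{M}_A\to\mathbf{M}_B$ preserves pullback diagrams of trivial fibrations; explicitly, for every trivial fibration $C\to D$ in $\mathbf{M}_A$ and every morphism $E\to D$ in $\mathbf{M}_A$, the map $C\amalg_AB\to D\amalg_AB$ is a trivial fibration and the natural map $(C\times_DE)\amalg_AB\to (C\amalg_AB)\times_{D\amalg_AB}(E\amalg_AB)$ is an isomorphism. Every flat morphism is preserved by pushouts, and if every cofibration is flat then $\mathbf{M}$ is left-proper. The category $\mathbf{M}(K)$: for $\mathbf{M}$ left-proper and $K\in\mathbf{M}$, $\mathbf{M}(K)$ is the full subcategory of the overcategory $\mathbf{M}\downarrow K$ whose objects are the morphisms $A\to K$ such that, for every morphism $h\colon E\to D$ in $\mathbf{M}_A$ with $A\to E$ and $A\to D$ flat, $h$ is a weak equivalence (respectively: an isomorphism) if and only if the induced map $E\amalg_AK\to D\amalg_AK$ is a weak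 equivalence (respectively: an isomorphism). Deformations: let $f\colon K\to X$ be a morphism with $X$ fibrant, and let $(A\xrightarrow{p}K)\in \mathbf{M}(K)$. A deformation of $f$ over $A\xrightarrow{p} K$ (written $A\to X_A\to X$) is a pair of morphisms $f_A\colon A\to X_A$ and $X_A\to X$ such that the composite $A\to X_A\to X$ equals $fp$, $f_A$ is flat, and the induced map $X_A\amalg_AK\to X$ is a weak equivalence. A direct equivalence between deformations $A\to Y_A\to X$ and $A\to X_A\to X$ is a morphism $h\colon Y_A\to X_A$ commuting with the maps from $A$ and with the maps to $X$. Two deformations are equivalent if they are so under the equivalence relation generated by direct equivalences. $\operatorname{Def}_f(A)$ denotes the class of deformations of $f$ over $A\to K$ modulo equivalence. *)

theory Defs
  imports Main
begin

section \<open>Categories\<close>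

record ('o, 'm) precat =
  obj :: "'o set"
  arr :: "'m set"
  dom :: "'m \<Rightarrow> 'o"
  cod :: "'m \<Rightarrow> 'o"
  ident :: "'o \<Rightarrow> 'm"
  cmp :: "'m \<Rightarrow> 'm \<Rightarrow> 'm"  (infixr "\<cdot>\<index>" 70)

text \<open>Composition is written in applicative order, \<open>g \<cdot> f\<close> meaning ``first \<open>f\<close>, then \<open>g\<close>'';
  only the values of \<open>dom\<close>, \<open>cod\<close>, \<open>ident\<close>, \<open>cmp\<close> on the carriers and on composable pairs matter.\<close>

definition hom :: "('o, 'm, 'z) precat_scheme \<Rightarrow> 'o \<Rightarrow> 'o \<Rightarrow> 'm set" where
  "hom C a b = {f \<in> arr C. dom C f = a \<and> cod C f = b}"

locale category =
  fixes C :: "('o, 'm, 'z) precat_scheme" (structure)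
  assumes dom_in: "f \<in> arr C \<Longrightarrow> dom C f \<in> obj C"
    and cod_in: "f \<in> arr C \<Longrightarrow> cod C f \<in> obj C"
    and ident_in: "a \<in> obj C \<Longrightarrow> ident C a \<in> hom C a a"
    and cmp_in: "f \<in> hom C a b \<Longrightarrow> g \<in> hom C b c \<Longrightarrow> g \<cdot> f \<in> hom C a c"
    and ident_right: "f \<in> hom C a b \<Longrightarrow> f \<cdot> ident C a = f"
    and ident_left: "f \<in> hom C a b \<Longrightarrow> ident C b \<cdot> f = f"
    and assoc: "f \<in> hom C a b \<Longrightarrow> g \<in> hom C b c \<Longrightarrow> h \<in> hom C c d \<Longrightarrow>
      (h \<cdot> g) \<cdot> f = h \<cdot> (g \<cdot> f)"

definition op_cat :: "('o, 'm, 'z) precat_scheme \<Rightarrow> ('o, 'm) precat" where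
  "op_cat C = \<lparr>obj = obj C, arr = arr C, dom = cod C, cod = dom C, ident = ident C,
    cmp = (\<lambda>g f. f \<cdot>\<^bsub>C\<^esub> g)\<rparr>"

definition iso :: "('o, 'm, 'z) precat_scheme \<Rightarrow> 'm \<Rightarrow> bool" where
  "iso C f \<longleftrightarrow> f \<in> arr C \<and>
    (\<exists>g \<in> hom C (cod C f) (dom C f).
      g \<cdot>\<^bsub>C\<^esub> f = ident C (dom C f) \<and> f \<cdot>\<^bsub>C\<^esub> g = ident C (cod C f))"

definition terminal :: "('o, 'm, 'z) precat_scheme \<Rightarrow> 'o \<Rightarrow> bool" where
  "terminal C t \<longleftrightarrow> t \<in> obj C \<and> (\<forall>a \<in> obj C. \<exists>!u. u \<in> hom C a t)"

subsection \<open>Finite limits and colimits\<close>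

definition is_functor ::
  "('i, 'j, 'y) precat_scheme \<Rightarrow> ('o, 'm, 'z) precat_scheme \<Rightarrow> ('i \<Rightarrow> 'o) \<Rightarrow> ('j \<Rightarrow> 'm) \<Rightarrow> bool" where
  "is_functor J C Fo Fa \<longleftrightarrow>
    (\<forall>i \<in> obj J. Fo i \<in> obj C \<and> Fa (ident J i) = ident C (Fo i)) \<and>
    (\<forall>f \<in> arr J. Fa f \<in> hom C (Fo (dom J f)) (Fo (cod J f))) \<and>
    (\<forall>f \<in> arr J. \<forall>g \<in> arr J. dom J g = cod J f \<longrightarrow> Fa (g \<cdot>\<^bsub>J\<^esub> f) = Fa g \<cdot>\<^bsub>C\<^esub> Fa f)"

definition is_cone ::
  "('i, 'j, 'y) precat_scheme \<Rightarrow> ('o, 'm, 'z) precat_scheme \<Rightarrow> ('i \<Rightarrow> 'o) \<Rightarrow> ('j \<Rightarrow> 'm) \<Rightarrow>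
    'o \<Rightarrow> ('i \<Rightarrow> 'm) \<Rightarrow> bool" where
  "is_cone J C Fo Fa L \<pi> \<longleftrightarrow> L \<in> obj C \<and>
    (\<forall>i \<in> obj J. \<pi> i \<in> hom C L (Fo i)) \<and>
    (\<forall>f \<in> arr J. Fa f \<cdot>\<^bsub>C\<^esub> \<pi> (dom J f) = \<pi> (cod J f))"

definition is_limit ::
  "('i, 'j, 'y) precat_scheme \<Rightarrow> ('o, 'm, 'z) precat_scheme \<Rightarrow> ('i \<Rightarrow> 'o) \<Rightarrow> ('j \<Rightarrow> 'm) \<Rightarrow>
    'o \<Rightarrow> ('i \<Rightarrow> 'm) \<Rightarrow> bool" where
  "is_limit J C Fo Fa L \<pi> \<longleftrightarrow> is_cone J C Fo Fa L \<pi> \<and>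
    (\<forall>L' \<pi>'. is_cone J C Fo Fa L' \<pi>' \<longrightarrow>
      (\<exists>!u. u \<in> hom C L' L \<and> (\<forall>i \<in> obj J. \<pi> i \<cdot>\<^bsub>C\<^esub> u = \<pi>' i)))"

text \<open>Every finite category is isomorphic to one whose objects and arrows are natural numbers,
  so these are all finite shapes.\<close>

definition has_finite_limits :: "('o, 'm, 'z) precat_scheme \<Rightarrow> bool" where
  "has_finite_limits C \<longleftrightarrow>
    (\<forall>(J :: (nat, nat) precat) Fo Fa.
      category J \<and> finite (obj J) \<and> finite (arr J) \<and> is_functor J C Fo Fa \<longrightarrow>
      (\<exists>L \<pi>. is_limit J C Fo Fa L \<pi>))"

definition has_finite_colimits :: "('o, 'm, 'z) precat_scheme \<Rightarrow> bool" where
  "has_finite_colimits C \<longleftrightarrow> has_finite_limits (op_cat C)"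

subsection \<open>Pushouts and pullbacks\<close>

definition is_pushout :: "('o, 'm, 'z) precat_scheme \<Rightarrow> 'm \<Rightarrow> 'm \<Rightarrow> 'm \<Rightarrow> 'm \<Rightarrow> bool" where
  "is_pushout C f g i j \<longleftrightarrow>
    f \<in> arr C \<and> g \<in> arr C \<and> i \<in> arr C \<and> j \<in> arr C \<and>
    dom C f = dom C g \<and> dom C i = cod C f \<and> dom C j = cod C g \<and> cod C i = cod C j \<and>
    i \<cdot>\<^bsub>C\<^esub> f = j \<cdot>\<^bsub>C\<^esub> g \<and>
    (\<forall>Q. \<forall>u \<in> hom C (cod C f) Q. \<forall>v \<in> hom C (cod C g) Q. u \<cdot>\<^bsub>C\<^esub> f = v \<cdot>\<^bsub>C\<^esub> g \<longrightarrow>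
      (\<exists>!w. w \<in> hom C (cod C i) Q \<and> w \<cdot>\<^bsub>C\<^esub> i = u \<and> w \<cdot>\<^bsub>C\<^esub> j = v))"

text \<open>A choice of pushout \<open>cod f \<rightarrow> P \<leftarrow> cod g\<close> of each span \<open>cod f \<leftarrow> A \<rightarrow> cod g\<close>, and the morphism
  \<open>P \<rightarrow> Q\<close> induced by \<open>u : cod f \<rightarrow> Q\<close> and \<open>v : cod g \<rightarrow> Q\<close>.  These are meaningful only where the
  pushout exists and \<open>u \<cdot> f = v \<cdot> g\<close>; likewise for pullbacks below.\<close>

definition po_inl :: "('o, 'm, 'z) precat_scheme \<Rightarrow> 'm \<Rightarrow> 'm \<Rightarrow> 'm" where
  "po_inl C f g = fst (SOME (i, j). is_pushout C f g i j)"

definition po_inr :: "('o, 'm, 'z) precat_scheme \<Rightarrow> 'm \<Rightarrow> 'm \<Rightarrow> 'm" where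
  "po_inr C f g = snd (SOME (i, j). is_pushout C f g i j)"

definition po_map :: "('o, 'm, 'z) precat_scheme \<Rightarrow> 'm \<Rightarrow> 'm \<Rightarrow> 'm \<Rightarrow> 'm \<Rightarrow> 'm" where
  "po_map C f g u v =
    (THE w. w \<in> hom C (cod C (po_inl C f g)) (cod C u) \<and>
      w \<cdot>\<^bsub>C\<^esub> po_inl C f g = u \<and> w \<cdot>\<^bsub>C\<^esub> po_inr C f g = v)"

definition is_pullback :: "('o, 'm, 'z) precat_scheme \<Rightarrow> 'm \<Rightarrow> 'm \<Rightarrow> 'm \<Rightarrow> 'm \<Rightarrow> bool" where
  "is_pullback C f g p q \<longleftrightarrow> is_pushout (op_cat C) f g p q"

definition pb_fst :: "('o, 'm, 'z) precat_scheme \<Rightarrow> 'm \<Rightarrow> 'm \<Rightarrow> 'm" where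
  "pb_fst C f g = fst (SOME (p, q). is_pullback C f g p q)"

definition pb_snd :: "('o, 'm, 'z) precat_scheme \<Rightarrow> 'm \<Rightarrow> 'm \<Rightarrow> 'm" where
  "pb_snd C f g = snd (SOME (p, q). is_pullback C f g p q)"

definition pb_map :: "('o, 'm, 'z) precat_scheme \<Rightarrow> 'm \<Rightarrow> 'm \<Rightarrow> 'm \<Rightarrow> 'm \<Rightarrow> 'm" where
  "pb_map C f g u v =
    (THE w. w \<in> hom C (dom C u) (dom C (pb_fst C f g)) \<and>
      pb_fst C f g \<cdot>\<^bsub>C\<^esub> w = u \<and> pb_snd C f g \<cdot>\<^bsub>C\<^esub> w = v)"

text \<open>The functor \<open>- \<amalg>\<^sub>A B\<close> along \<open>b : A \<rightarrow> B\<close> sends an object \<open>c : A \<rightarrow> C\<close> of the undercategory of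
  \<open>A\<close> to \<open>po_inr C c b : B \<rightarrow> C \<amalg>\<^sub>A B\<close>.  On a morphism \<open>h : C \<rightarrow> D\<close> from \<open>c\<close> to \<open>d = h \<cdot> c\<close>
  it is the following map \<open>C \<amalg>\<^sub>A B \<rightarrow> D \<amalg>\<^sub>A B\<close>.\<close>

definition cobase_map :: "('o, 'm, 'z) precat_scheme \<Rightarrow> 'm \<Rightarrow> 'm \<Rightarrow> 'm \<Rightarrow> 'm" where
  "cobase_map C b c h =
    po_map C c b (po_inl C (h \<cdot>\<^bsub>C\<^esub> c) b \<cdot>\<^bsub>C\<^esub> h) (po_inr C (h \<cdot>\<^bsub>C\<^esub> c) b)"

section \<open>Model categories\<close>

record ('o, 'm) model_cat = "('o, 'm) precat" +
  weq :: "'m set"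
  fib :: "'m set"
  cofib :: "'m set"

definition retract_of :: "('o, 'm, 'z) precat_scheme \<Rightarrow> 'm \<Rightarrow> 'm \<Rightarrow> bool" where
  "retract_of C f g \<longleftrightarrow> f \<in> arr C \<and> g \<in> arr C \<and>
    (\<exists>i \<in> hom C (dom C f) (dom C g). \<exists>r \<in> hom C (dom C g) (dom C f).
     \<exists>i' \<in> hom C (cod C f) (cod C g). \<exists>r' \<in> hom C (cod C g) (cod C f).
      r \<cdot>\<^bsub>C\<^esub> i = ident C (dom C f) \<and> r' \<cdot>\<^bsub>C\<^esub> i' = ident C (cod C f) \<and>
      g \<cdot>\<^bsub>C\<^esub> i = i' \<cdot>\<^bsub>C\<^esub> f \<and> f \<cdot>\<^bsub>C\<^esub> r = r' \<cdot>\<^bsub>C\<^esub> g)"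

definition has_lift :: "('o, 'm, 'z) precat_scheme \<Rightarrow> 'm \<Rightarrow> 'm \<Rightarrow> bool" where
  "has_lift C i p \<longleftrightarrow>
    (\<forall>u \<in> hom C (dom C i) (dom C p). \<forall>v \<in> hom C (cod C i) (cod C p).
      p \<cdot>\<^bsub>C\<^esub> u = v \<cdot>\<^bsub>C\<^esub> i \<longrightarrow>
      (\<exists>h \<in> hom C (cod C i) (dom C p). h \<cdot>\<^bsub>C\<^esub> i = u \<and> p \<cdot>\<^bsub>C\<^esub> h = v))"

text \<open>Quillen's closed model categories.  Only finite limits and colimits are required, and the
  factorisations need not be functorial.\<close>

locale model_category = category M
  for M :: "('o, 'm, 'z) model_cat_scheme" (structure) +
  assumes classes: "weq M \<subseteq> arr M" "fib M \<subseteq> arr M" "cofib M \<subseteq> arr M"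
    and finite_limits: "has_finite_limits M"
    and finite_colimits: "has_finite_colimits M"
    and two_of_three:
      "\<And>a b c f g. f \<in> hom M a b \<Longrightarrow> g \<in> hom M b c \<Longrightarrow>
        f \<in> weq M \<Longrightarrow> g \<in> weq M \<Longrightarrow> g \<cdot> f \<in> weq M"
      "\<And>a b c f g. f \<in> hom M a b \<Longrightarrow> g \<in> hom M b c \<Longrightarrow>
        f \<in> weq M \<Longrightarrow> g \<cdot> f \<in> weq M \<Longrightarrow> g \<in> weq M"
      "\<And>a b c f g. f \<in> hom M a b \<Longrightarrow> g \<in> hom M b c \<Longrightarrow>
        g \<in> weq M \<Longrightarrow> g \<cdot> f \<in> weq M \<Longrightarrow> f \<in> weq M"
    and retract:
      "\<And>f g. retract_of M f g \<Longrightarrow> g \<in> weq M \<Longrightarrow> f \<in> weq M"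
      "\<And>f g. retract_of M f g \<Longrightarrow> g \<in> fib M \<Longrightarrow> f \<in> fib M"
      "\<And>f g. retract_of M f g \<Longrightarrow> g \<in> cofib M \<Longrightarrow> f \<in> cofib M"
    and lifting:
      "\<And>i p. i \<in> cofib M \<inter> weq M \<Longrightarrow> p \<in> fib M \<Longrightarrow> has_lift M i p"
      "\<And>i p. i \<in> cofib M \<Longrightarrow> p \<in> fib M \<inter> weq M \<Longrightarrow> has_lift M i p"
    and factorisation:
      "\<And>f. f \<in> arr M \<Longrightarrow>
        \<exists>i \<in> cofib M \<inter> weq M. \<exists>p \<in> fib M. cod M i = dom M p \<and> p \<cdot> i = f"
      "\<And>f. f \<in> arr M \<Longrightarrow>
        \<exists>i \<in> cofib M. \<exists>p \<in> fib M \<inter> weq M. cod M i = dom M p \<and> p \<cdot> i = f"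

definition fibrant :: "('o, 'm, 'z) model_cat_scheme \<Rightarrow> 'o \<Rightarrow> bool" where
  "fibrant M X \<longleftrightarrow> (\<exists>t \<in> fib M. dom M t = X \<and> terminal M (cod M t))"

section \<open>Flat morphisms and the category \<open>M(K)\<close>\<close>

text \<open>In the undercategory of \<open>A = dom b\<close>, \<open>s : C \<rightarrow> D\<close> runs over the trivial fibrations out of
  \<open>c : A \<rightarrow> C\<close>, and \<open>t : E \<rightarrow> D\<close> over the morphisms from some \<open>e : A \<rightarrow> E\<close> to \<open>s \<cdot> c\<close>; then \<open>q\<close> is
  the fibre product \<open>A \<rightarrow> C \<times>\<^sub>D E\<close>.  The last clause concerns the natural map
  \<open>(C \<times>\<^sub>D E) \<amalg>\<^sub>A B \<rightarrow> (C \<amalg>\<^sub>A B) \<times>\<^sub>D\<^sub>B (E \<amalg>\<^sub>A B)\<close>, where \<open>DB = D \<amalg>\<^sub>A B\<close>.\<close>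

definition flat :: "('o, 'm, 'z) model_cat_scheme \<Rightarrow> 'm \<Rightarrow> bool" where
  "flat M b \<longleftrightarrow> b \<in> arr M \<and>
    (\<forall>c s. c \<in> arr M \<and> dom M c = dom M b \<and> s \<in> fib M \<inter> weq M \<and> dom M s = cod M c \<longrightarrow>
      cobase_map M b c s \<in> fib M \<inter> weq M \<and>
      (\<forall>e t. e \<in> arr M \<and> dom M e = dom M b \<and> t \<in> hom M (cod M e) (cod M s) \<and>
          t \<cdot>\<^bsub>M\<^esub> e = s \<cdot>\<^bsub>M\<^esub> c \<longrightarrow>
        (let q = pb_map M s t c e in
          iso M (pb_map M (cobase_map M b c s) (cobase_map M b e t)
            (cobase_map M b q (pb_fst M s t)) (cobase_map M b q (pb_snd M s t))))))"

text \<open>The objects of \<open>M(K)\<close>, each identified with its structure morphism \<open>p : A \<rightarrow> K\<close>.\<close>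

definition MK_obj :: "('o, 'm, 'z) model_cat_scheme \<Rightarrow> 'o \<Rightarrow> 'm set" where
  "MK_obj M K = {p \<in> arr M. cod M p = K \<and>
    (\<forall>e h. flat M e \<and> dom M e = dom M p \<and> h \<in> arr M \<and> dom M h = cod M e \<and> flat M (h \<cdot>\<^bsub>M\<^esub> e) \<longrightarrow>
      (h \<in> weq M \<longleftrightarrow> cobase_map M p e h \<in> weq M) \<and>
      (iso M h \<longleftrightarrow> iso M (cobase_map M p e h)))}"

section \<open>Deformations\<close>

text \<open>A deformation \<open>A \<rightarrow> X\<^sub>A \<rightarrow> X\<close> of \<open>f : K \<rightarrow> X\<close> over \<open>p : A \<rightarrow> K\<close> is encoded as the pair of its two
  morphisms.\<close>

definition deformations :: "('o, 'm, 'z) model_cat_scheme \<Rightarrow> 'm \<Rightarrow> 'm \<Rightarrow> ('m \<times> 'm) set" where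
  "deformations M f p = {(fA, m). flat M fA \<and> dom M fA = dom M p \<and>
    m \<in> hom M (cod M fA) (cod M f) \<and> m \<cdot>\<^bsub>M\<^esub> fA = f \<cdot>\<^bsub>M\<^esub> p \<and> po_map M fA p m f \<in> weq M}"

definition direct_equiv ::
  "('o, 'm, 'z) model_cat_scheme \<Rightarrow> 'm \<Rightarrow> 'm \<Rightarrow> (('m \<times> 'm) \<times> ('m \<times> 'm)) set" where
  "direct_equiv M f p = {((fY, n), (fX, m)).
    (fY, n) \<in> deformations M f p \<and> (fX, m) \<in> deformations M f p \<and>
    (\<exists>h \<in> hom M (cod M fY) (cod M fX). h \<cdot>\<^bsub>M\<^esub> fY = fX \<and> m \<cdot>\<^bsub>M\<^esub> h = n)}"

definition def_equiv ::
  "('o, 'm, 'z) model_cat_scheme \<Rightarrow> 'm \<Rightarrow> 'm \<Rightarrow> (('m \<times> 'm) \<times> ('m \<times> 'm)) set" where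
  "def_equiv M f p =
    Restr ((direct_equiv M f p \<union> (direct_equiv M f p)\<inverse>)\<^sup>*) (deformations M f p)"

definition Def :: "('o, 'm, 'z) model_cat_scheme \<Rightarrow> 'm \<Rightarrow> 'm \<Rightarrow> ('m \<times> 'm) set set" where
  "Def M f p = deformations M f p // def_equiv M f p"

text \<open>The union is over the representatives of the class \<open>c\<close>.  It is a single class, hence an element
  of \<open>Def M (\<tau> \<cdot> f) p\<close>, precisely when the construction on representatives is well defined.\<close>

definition Def_map ::
  "('o, 'm, 'z) model_cat_scheme \<Rightarrow> 'm \<Rightarrow> 'm \<Rightarrow> 'm \<Rightarrow> ('m \<times> 'm) set \<Rightarrow> ('m \<times> 'm) set" where
  "Def_map M \<tau> f p c = (\<Union>(fA, m) \<in> c. def_equiv M (\<tau> \<cdot>\<^bsub>M\<^esub> f) p `` {(fA, \<tau> \<cdot>\<^bsub>M\<^esub> m)})"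

end

theory Submission
  imports Defs
begin

text \<open>
  Write \<open>t\<^sub>* (A \<rightarrow> X\<^sub>A \<rightarrow> X) = (A \<rightarrow> X\<^sub>A \<rightarrow> X \<rightarrow> Y)\<close> for a weak equivalence \<open>t : X \<rightarrow> Y\<close> (\<open>post\<close> below).
  It respects equivalence of deformations, so bijectivity on classes means that \<open>t\<^sub>*\<close> reflects
  equivalence (\<open>reflects\<close>) and reaches every deformation up to equivalence (\<open>ess_surj\<close>).  Both
  properties are shown for two kinds of maps, and a weak equivalence of fibrant objects is composed
  of these.

  Let \<open>t\<close> be a trivial fibration.  A deformation \<open>A \<rightarrow> Y\<^sub>A \<rightarrow> Y\<close> of \<open>t \<cdot> f\<close> is pulled back to
  \<open>Z = Y\<^sub>A \<times>\<^sub>Y X\<close>, and \<open>A \<rightarrow> Z\<close> is factored into a cofibration \<open>A \<rightarrow> W\<close> and a trivial fibration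
  \<open>W \<rightarrow> Z\<close>.  Cofibrations are flat, \<open>W \<rightarrow> Y\<^sub>A\<close> is a weak equivalence, and \<open>p\<close> lies in \<open>M(K)\<close>;
  so \<open>W\<close> is a deformation of \<open>f\<close>, and it maps to \<open>Y\<^sub>A\<close> as a deformation of \<open>t \<cdot> f\<close>
  (\<open>pulled_back_over\<close>).  If \<open>A \<rightarrow> V\<close> is a cofibration, then a map \<open>V \<rightarrow> Z\<close> under \<open>A\<close>
  lifts to \<open>W\<close> (\<open>cofibrant_maps_to_pulled_back\<close>).  Hence a direct equivalence downstairs induces
  one between the objects pulled back, and the object pulled back from \<open>t\<^sub>* F\<close> is equivalent to \<open>F\<close>.  Following a
  zigzag from \<open>t\<^sub>* F\<close> to \<open>t\<^sub>* F'\<close> in this way gives an equivalence from \<open>F\<close> to \<open>F'\<close>.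

  Let \<open>j : X \<rightarrow> Z\<close> be a trivial cofibration of fibrant objects.  It has a retraction \<open>r\<close>, again a weak
  equivalence, and \<open>r\<^sub>* j\<^sub>* = id\<close>; so \<open>j\<^sub>*\<close> reflects equivalence.  It is essentially surjective as
  soon as \<open>r\<^sub>*\<close> reflects equivalence, since \<open>r\<^sub>*\<close> takes both \<open>j\<^sub>* r\<^sub>* D\<close> and \<open>D\<close> to \<open>r\<^sub>* D\<close>.  And
  \<open>r\<^sub>*\<close> does so because \<open>r\<close> is a trivial cofibration out of the fibrant object \<open>Z\<close> followed by a
  trivial fibration.

  Finally \<open>\<tau> = q \<cdot> j\<close> with \<open>j\<close> a trivial cofibration and \<open>q\<close> a trivial fibration, and the
  intermediate object is fibrant because \<open>Y\<close> is.
\<close>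

section \<open>Pullbacks, pushouts and lifting\<close>

context category
begin

lemma homD: "f \<in> hom C a b \<Longrightarrow> f \<in> arr C \<and> dom C f = a \<and> cod C f = b \<and> a \<in> obj C \<and> b \<in> obj C"
  using dom_in cod_in by (auto simp: hom_def)

lemma arr_hom: "f \<in> arr C \<Longrightarrow> f \<in> hom C (dom C f) (cod C f)"
  by (simp add: hom_def)

lemma pullbackD:
  assumes "is_pullback C f g p q" and "f \<in> hom C a c" and "g \<in> hom C b c"
  shows "p \<in> hom C (dom C p) a" "q \<in> hom C (dom C p) b" "f \<cdot> p = g \<cdot> q"
    "\<And>Q u v. u \<in> hom C Q a \<Longrightarrow> v \<in> hom C Q b \<Longrightarrow> f \<cdot> u = g \<cdot> v \<Longrightarrow>
      \<exists>!w. w \<in> hom C Q (dom C p) \<and> p \<cdot> w = u \<and> q \<cdot> w = v"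
proof -
  note A = assms(1)[unfolded is_pullback_def is_pushout_def]
  have dc: "dom C f = a" "cod C f = c" "dom C g = b" "cod C g = c"
    using homD[OF assms(2)] homD[OF assms(3)] by auto
  show "p \<in> hom C (dom C p) a" "q \<in> hom C (dom C p) b" "f \<cdot> p = g \<cdot> q"
    using A dc by (auto simp: op_cat_def hom_def)
  have univ: "\<forall>Q. \<forall>u \<in> hom (op_cat C) (cod (op_cat C) f) Q. \<forall>v \<in> hom (op_cat C) (cod (op_cat C) g) Q.
      u \<cdot>\<^bsub>op_cat C\<^esub> f = v \<cdot>\<^bsub>op_cat C\<^esub> g \<longrightarrow>
      (\<exists>!w. w \<in> hom (op_cat C) (cod (op_cat C) p) Q \<and>
        w \<cdot>\<^bsub>op_cat C\<^esub> p = u \<and> w \<cdot>\<^bsub>op_cat C\<^esub> q = v)"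
    using A by blast
  show "\<exists>!w. w \<in> hom C Q (dom C p) \<and> p \<cdot> w = u \<and> q \<cdot> w = v"
    if u: "u \<in> hom C Q a" and v: "v \<in> hom C Q b" and eq: "f \<cdot> u = g \<cdot> v" for Q u v
  proof -
    have "u \<in> hom (op_cat C) (cod (op_cat C) f) Q" "v \<in> hom (op_cat C) (cod (op_cat C) g) Q"
      "u \<cdot>\<^bsub>op_cat C\<^esub> f = v \<cdot>\<^bsub>op_cat C\<^esub> g"
      using u v eq dc by (auto simp: op_cat_def hom_def)
    from univ[rule_format, OF this] show ?thesis by (simp add: op_cat_def hom_def conj_ac)
  qed
qed

lemma pushoutD:
  assumes "is_pushout C f g i j" and "f \<in> hom C a b" and "g \<in> hom C a c"
  shows "i \<in> hom C b (cod C i)" "j \<in> hom C c (cod C i)" "i \<cdot> f = j \<cdot> g"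
    "\<And>Q u v. u \<in> hom C b Q \<Longrightarrow> v \<in> hom C c Q \<Longrightarrow> u \<cdot> f = v \<cdot> g \<Longrightarrow>
      \<exists>!w. w \<in> hom C (cod C i) Q \<and> w \<cdot> i = u \<and> w \<cdot> j = v"
proof -
  note A = assms(1)[unfolded is_pushout_def]
  have dc: "dom C f = a" "cod C f = b" "dom C g = a" "cod C g = c"
    using homD[OF assms(2)] homD[OF assms(3)] by auto
  show "i \<in> hom C b (cod C i)" "j \<in> hom C c (cod C i)" "i \<cdot> f = j \<cdot> g"
    using A dc by (auto simp: hom_def)
  show "\<exists>!w. w \<in> hom C (cod C i) Q \<and> w \<cdot> i = u \<and> w \<cdot> j = v"
    if "u \<in> hom C b Q" "v \<in> hom C c Q" "u \<cdot> f = v \<cdot> g" for Q u v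
    using A that unfolding dc by blast
qed

lemma category_op_cat: "category (op_cat C)"
proof
  fix f g h a b c d
  show "dom (op_cat C) f \<in> obj (op_cat C)" "cod (op_cat C) f \<in> obj (op_cat C)"
    if "f \<in> arr (op_cat C)"
    using that dom_in cod_in by (simp_all add: op_cat_def)
  show "ident (op_cat C) a \<in> hom (op_cat C) a a" if "a \<in> obj (op_cat C)"
    using that ident_in[of a] by (simp add: op_cat_def hom_def)
  show "g \<cdot>\<^bsub>op_cat C\<^esub> f \<in> hom (op_cat C) a c"
    if "f \<in> hom (op_cat C) a b" "g \<in> hom (op_cat C) b c"
    using that cmp_in[of g c b f a] by (simp add: op_cat_def hom_def)
  show "f \<cdot>\<^bsub>op_cat C\<^esub> ident (op_cat C) a = f" "ident (op_cat C) b \<cdot>\<^bsub>op_cat C\<^esub> f = f"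
    if "f \<in> hom (op_cat C) a b"
    using that ident_left[of f b a] ident_right[of f b a] by (simp_all add: op_cat_def hom_def)
  show "(h \<cdot>\<^bsub>op_cat C\<^esub> g) \<cdot>\<^bsub>op_cat C\<^esub> f = h \<cdot>\<^bsub>op_cat C\<^esub> (g \<cdot>\<^bsub>op_cat C\<^esub> f)"
    if "f \<in> hom (op_cat C) a b" "g \<in> hom (op_cat C) b c" "h \<in> hom (op_cat C) c d"
    using that assoc[of h d c g b f a] by (simp add: op_cat_def hom_def)
qed

end

text \<open>The shape \<open>0 \<rightarrow> 2 \<leftarrow> 1\<close>, with identities \<open>0, 1, 2\<close> and the two other arrows \<open>3 : 0 \<rightarrow> 2\<close> and
  \<open>4 : 1 \<rightarrow> 2\<close>.  Every composable pair contains an identity, which determines composition.\<close>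

definition cospan :: "(nat, nat) precat" where
  "cospan = \<lparr>obj = {0, 1, 2}, arr = {0, 1, 2, 3, 4}, dom = (\<lambda>n. if n < 3 then n else n - 3),
    cod = (\<lambda>n. if n < 3 then n else 2), ident = (\<lambda>n. n), cmp = (\<lambda>g f. if g < 3 then f else g)\<rparr>"

lemma category_cospan: "category cospan"
  by unfold_locales (auto simp: cospan_def hom_def split: if_splits)

lemma (in category) pullback_exists:
  assumes "has_finite_limits C" and f: "f \<in> hom C a c" and g: "g \<in> hom C b c"
  shows "\<exists>p q. is_pullback C f g p q"
proof -
  define Fo where "Fo n = (if n = 0 then a else if n = 1 then b else c)" for n :: nat
  define Fa where "Fa n = (if n = 3 then f else if n = 4 then g else ident C (Fo n))" for n :: nat
  have abc: "a \<in> obj C" "b \<in> obj C" "c \<in> obj C"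
    using homD[OF f] homD[OF g] by auto
  have ids: "ident C x \<in> hom C x x" "ident C x \<cdot> ident C x = ident C x" if "x \<in> obj C" for x
    using that ident_in[of x] ident_left[of "ident C x" x x] by auto
  have "is_functor cospan C Fo Fa"
    using abc ids f g ident_left[OF f] ident_right[OF f] ident_left[OF g] ident_right[OF g]
    by (auto simp: is_functor_def cospan_def Fo_def Fa_def)
  moreover have "finite (obj cospan)" "finite (arr cospan)"
    by (simp_all add: cospan_def)
  ultimately obtain L \<pi> where lim: "is_limit cospan C Fo Fa L \<pi>"
    using assms(1) category_cospan unfolding has_finite_limits_def by blast
  have cone: "is_cone cospan C Fo Fa L \<pi>"
    using lim by (simp add: is_limit_def)
  have pi: "\<pi> 0 \<in> hom C L a" "\<pi> 1 \<in> hom C L b" "\<pi> 2 \<in> hom C L c"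
      "f \<cdot> \<pi> 0 = \<pi> 2" "g \<cdot> \<pi> 1 = \<pi> 2"
    using cone by (auto simp: is_cone_def cospan_def Fo_def Fa_def)
  have univ: "\<exists>!w. w \<in> hom C Q L \<and> \<pi> 0 \<cdot> w = u \<and> \<pi> 1 \<cdot> w = v"
    if u: "u \<in> hom C Q a" and v: "v \<in> hom C Q b" and eq: "f \<cdot> u = g \<cdot> v" for Q u v
  proof -
    define \<rho> where "\<rho> n = (if n = 0 then u else if n = 1 then v else f \<cdot> u)" for n :: nat
    have "is_cone cospan C Fo Fa Q \<rho>"
      using u v eq homD[OF u] cmp_in[OF u f] ident_left[OF u] ident_left[OF v]
        ident_left[OF cmp_in[OF u f]]
      by (auto simp: is_cone_def cospan_def Fo_def Fa_def \<rho>_def)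
    then have ex: "\<exists>!w. w \<in> hom C Q L \<and> (\<forall>i \<in> obj cospan. \<pi> i \<cdot> w = \<rho> i)"
      using lim by (simp add: is_limit_def)
    have "(\<forall>i \<in> obj cospan. \<pi> i \<cdot> w = \<rho> i) \<longleftrightarrow> \<pi> 0 \<cdot> w = u \<and> \<pi> 1 \<cdot> w = v"
      if w: "w \<in> hom C Q L" for w
      using assoc[OF w pi(1) f] pi(4) by (auto simp: cospan_def \<rho>_def)
    then have "(w \<in> hom C Q L \<and> (\<forall>i \<in> obj cospan. \<pi> i \<cdot> w = \<rho> i)) \<longleftrightarrow>
        (w \<in> hom C Q L \<and> \<pi> 0 \<cdot> w = u \<and> \<pi> 1 \<cdot> w = v)" for w
      by blast
    with ex show ?thesis by simp
  qed
  have "is_pullback C f g (\<pi> 0) (\<pi> 1)"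
    unfolding is_pullback_def is_pushout_def
  proof (intro conjI allI ballI impI)
    fix Q u v
    assume "u \<in> hom (op_cat C) (cod (op_cat C) f) Q" "v \<in> hom (op_cat C) (cod (op_cat C) g) Q"
      "u \<cdot>\<^bsub>op_cat C\<^esub> f = v \<cdot>\<^bsub>op_cat C\<^esub> g"
    then have "u \<in> hom C Q a" "v \<in> hom C Q b" "f \<cdot> u = g \<cdot> v"
      using f g by (auto simp: op_cat_def hom_def)
    from univ[OF this] show "\<exists>!w. w \<in> hom (op_cat C) (cod (op_cat C) (\<pi> 0)) Q \<and>
        w \<cdot>\<^bsub>op_cat C\<^esub> \<pi> 0 = u \<and> w \<cdot>\<^bsub>op_cat C\<^esub> \<pi> 1 = v"
      using pi(1) by (simp add: op_cat_def hom_def conj_ac)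
  qed (use pi f g in \<open>auto simp: op_cat_def hom_def\<close>)
  then show ?thesis by blast
qed

lemma (in category) pushout_exists:
  assumes "has_finite_colimits C" and "f \<in> hom C a b" and "g \<in> hom C a c"
  shows "\<exists>i j. is_pushout C f g i j"
proof -
  have "f \<in> hom (op_cat C) b a" "g \<in> hom (op_cat C) c a"
    using assms(2,3) by (auto simp: op_cat_def hom_def)
  then obtain i j where "is_pullback (op_cat C) f g i j"
    using category.pullback_exists[OF category_op_cat] assms(1)
    unfolding has_finite_colimits_def by blast
  moreover have "is_pullback (op_cat C) f g i j \<longleftrightarrow> is_pushout C f g i j"
    by (simp add: is_pullback_def is_pushout_def op_cat_def hom_def)
  ultimately show ?thesis by blast
qed

context category
begin

lemma has_liftD:
  assumes "has_lift C i q" "i \<in> hom C a b" "q \<in> hom C c d" "u \<in> hom C a c" "v \<in> hom C b d"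
    "q \<cdot> u = v \<cdot> i"
  obtains h where "h \<in> hom C b c" "h \<cdot> i = u" "q \<cdot> h = v"
  using assms unfolding has_lift_def by (metis homD)

lemma has_lift_comp:
  assumes f: "f \<in> hom C a b" and g: "g \<in> hom C b c" and i: "i \<in> arr C"
    and lf: "has_lift C i f" and lg: "has_lift C i g"
  shows "has_lift C i (g \<cdot> f)"
  unfolding has_lift_def
proof (intro ballI impI)
  note i = arr_hom[OF i]
  fix u v
  assume "u \<in> hom C (dom C i) (dom C (g \<cdot> f))" "v \<in> hom C (cod C i) (cod C (g \<cdot> f))"
    and eq: "(g \<cdot> f) \<cdot> u = v \<cdot> i"
  then have u: "u \<in> hom C (dom C i) a" and v: "v \<in> hom C (cod C i) c"
    using homD[OF cmp_in[OF f g]] by auto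
  have "g \<cdot> (f \<cdot> u) = v \<cdot> i" using eq assoc[OF u f g] by simp
  then obtain k where k: "k \<in> hom C (cod C i) b" "k \<cdot> i = f \<cdot> u" "g \<cdot> k = v"
    using has_liftD[OF lg i g cmp_in[OF u f] v] by blast
  then obtain h where h: "h \<in> hom C (cod C i) a" "h \<cdot> i = u" "f \<cdot> h = k"
    using has_liftD[OF lf i f u k(1)] by metis
  then have "(g \<cdot> f) \<cdot> h = v" using assoc[OF h(1) f g] k(3) by simp
  then show "\<exists>h \<in> hom C (cod C i) (dom C (g \<cdot> f)). h \<cdot> i = u \<and> (g \<cdot> f) \<cdot> h = v"
    using h homD[OF cmp_in[OF f g]] by auto
qed

lemma has_lift_pullback:
  assumes pb: "is_pullback C n t p q" and n: "n \<in> hom C a c" and t: "t \<in> hom C b c"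
    and i: "i \<in> arr C" and lt: "has_lift C i t"
  shows "has_lift C i p"
  unfolding has_lift_def
proof (intro ballI impI)
  note i = arr_hom[OF i]
  define P where "P = dom C p"
  note p = pullbackD(1)[OF pb n t, folded P_def] and q = pullbackD(2)[OF pb n t, folded P_def]
    and sq = pullbackD(3)[OF pb n t] and univ = pullbackD(4)[OF pb n t, folded P_def]
  fix u v
  assume "u \<in> hom C (dom C i) (dom C p)" "v \<in> hom C (cod C i) (cod C p)" and eq: "p \<cdot> u = v \<cdot> i"
  then have u: "u \<in> hom C (dom C i) P" and v: "v \<in> hom C (cod C i) a"
    using homD[OF p] by auto
  have sq': "t \<cdot> (q \<cdot> u) = (n \<cdot> v) \<cdot> i"
    using assoc[OF u q t] assoc[OF u p n] assoc[OF i v n] sq eq by simp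
  obtain k where k: "k \<in> hom C (cod C i) b" "k \<cdot> i = q \<cdot> u" "t \<cdot> k = n \<cdot> v"
    using has_liftD[OF lt i t cmp_in[OF u q] cmp_in[OF v n] sq'] .
  obtain h where h: "h \<in> hom C (cod C i) P" "p \<cdot> h = v" "q \<cdot> h = k"
    using univ[OF v k(1)] k(3) by auto
  \<comment> \<open>The upper triangle commutes by the uniqueness part of the universal property.\<close>
  have "n \<cdot> (p \<cdot> u) = t \<cdot> (q \<cdot> u)"
    using assoc[OF u q t] assoc[OF u p n] sq by simp
  then have "\<exists>!w. w \<in> hom C (dom C i) P \<and> p \<cdot> w = p \<cdot> u \<and> q \<cdot> w = q \<cdot> u"
    using univ[OF cmp_in[OF u p] cmp_in[OF u q]] by blast
  moreover have "p \<cdot> (h \<cdot> i) = p \<cdot> u" "q \<cdot> (h \<cdot> i) = q \<cdot> u"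
    using assoc[OF i h(1) p] assoc[OF i h(1) q] h eq k(2) by auto
  ultimately have "h \<cdot> i = u"
    using cmp_in[OF i h(1)] u by blast
  then show "\<exists>h \<in> hom C (cod C i) (dom C p). h \<cdot> i = u \<and> p \<cdot> h = v"
    using h homD[OF p] by auto
qed

text \<open>The retract argument: the lift of \<open>f = q \<cdot> i\<close> against \<open>i\<close> splits \<open>i\<close> compatibly with the maps
  to the codomain.\<close>

lemma retract_argument:
  assumes i: "i \<in> hom C a b" and q: "q \<in> hom C b c" and l: "has_lift C i (q \<cdot> i)"
  shows "retract_of C (q \<cdot> i) q"
proof -
  have f: "q \<cdot> i \<in> hom C a c" using cmp_in[OF i q] .
  have a: "ident C a \<in> hom C a a" and c: "ident C c \<in> hom C c c"
    using ident_in homD[OF f] by auto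
  obtain h where h: "h \<in> hom C b a" "h \<cdot> i = ident C a" "(q \<cdot> i) \<cdot> h = q"
    using has_liftD[OF l i f a q] ident_right[OF f] by metis
  show ?thesis
    unfolding retract_of_def
    using homD[OF f] homD[OF q] i h c ident_left[OF c] ident_left[OF f] ident_left[OF q]
    by metis
qed

end

section \<open>Fibrations\<close>

context model_category
begin

lemma fibI:
  assumes f: "f \<in> arr M" and l: "\<And>i. i \<in> cofib M \<inter> weq M \<Longrightarrow> has_lift M i f"
  shows "f \<in> fib M"
proof -
  obtain i q where i: "i \<in> cofib M \<inter> weq M" and q: "q \<in> fib M" "cod M i = dom M q" "q \<cdot> i = f"
    using factorisation(1)[OF f] by blast
  have "i \<in> hom M (dom M i) (dom M q)" "q \<in> hom M (dom M q) (cod M q)"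
    using i q classes by (auto simp: hom_def)
  then have "retract_of M f q" using retract_argument l[OF i] q(3) by blast
  then show ?thesis using retract(2) q(1) by blast
qed

lemma trivial_fibI:
  assumes f: "f \<in> arr M" and l: "\<And>i. i \<in> cofib M \<Longrightarrow> has_lift M i f"
  shows "f \<in> fib M \<inter> weq M"
proof -
  obtain i q where i: "i \<in> cofib M" and q: "q \<in> fib M \<inter> weq M" "cod M i = dom M q" "q \<cdot> i = f"
    using factorisation(2)[OF f] by blast
  have "i \<in> hom M (dom M i) (dom M q)" "q \<in> hom M (dom M q) (cod M q)"
    using i q classes by (auto simp: hom_def)
  then have "retract_of M f q" using retract_argument l[OF i] q(3) by blast
  then show ?thesis using retract(1,2) q(1) by blast
qed

lemma fib_comp:
  assumes f: "f \<in> hom M a b" "f \<in> fib M" and g: "g \<in> hom M b c" "g \<in> fib M"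
  shows "g \<cdot> f \<in> fib M"
proof (rule fibI)
  show "g \<cdot> f \<in> arr M" using homD[OF cmp_in[OF f(1) g(1)]] by blast
  show "has_lift M i (g \<cdot> f)" if "i \<in> cofib M \<inter> weq M" for i
    using has_lift_comp[OF f(1) g(1)] lifting(1)[OF that f(2)] lifting(1)[OF that g(2)] that classes
    by blast
qed

lemma trivial_fib_pullback:
  assumes pb: "is_pullback M n t p q" and n: "n \<in> hom M a c" and t: "t \<in> hom M b c"
    and tf: "t \<in> fib M \<inter> weq M"
  shows "p \<in> fib M \<inter> weq M"
proof (rule trivial_fibI)
  show "p \<in> arr M" using homD[OF pullbackD(1)[OF pb n t]] by blast
  show "has_lift M i p" if "i \<in> cofib M" for i
    using has_lift_pullback[OF pb n t _ lifting(2)[OF that tf]] that classes by blast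
qed

text \<open>By two-out-of-three, the fibration in the factorisation is trivial as well.\<close>

lemma weq_fact:
  assumes "f \<in> hom M a b" "f \<in> weq M"
  obtains i q c where "i \<in> hom M a c" "i \<in> cofib M" "i \<in> weq M"
    "q \<in> hom M c b" "q \<in> fib M" "q \<in> weq M" "q \<cdot> i = f"
proof -
  have arr: "f \<in> arr M" using homD[OF assms(1)] by blast
  obtain i q where i: "i \<in> cofib M \<inter> weq M" and q: "q \<in> fib M" "cod M i = dom M q" "q \<cdot> i = f"
    using factorisation(1)[OF arr] by blast
  have i': "i \<in> hom M (dom M i) (dom M q)" and q': "q \<in> hom M (dom M q) (cod M q)"
    using i q classes by (auto simp: hom_def)
  have "dom M i = a" "cod M q = b"
    using homD[OF cmp_in[OF i' q']] homD[OF assms(1)] q(3) by auto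
  moreover have "q \<in> weq M" using two_of_three(2)[OF i' q'] i q(3) assms(2) by blast
  ultimately show ?thesis using that i i' q q' by blast
qed

lemma cofib_fact:
  assumes "f \<in> hom M a b"
  obtains i q c where "i \<in> hom M a c" "i \<in> cofib M" "q \<in> hom M c b" "q \<in> fib M \<inter> weq M" "q \<cdot> i = f"
proof -
  have arr: "f \<in> arr M" using homD[OF assms(1)] by blast
  obtain i q where i: "i \<in> cofib M" and q: "q \<in> fib M \<inter> weq M" "cod M i = dom M q" "q \<cdot> i = f"
    using factorisation(2)[OF arr] by blast
  have i': "i \<in> hom M (dom M i) (dom M q)" and q': "q \<in> hom M (dom M q) (cod M q)"
    using i q classes by (auto simp: hom_def)
  have "dom M i = a" "cod M q = b"
    using homD[OF cmp_in[OF i' q']] homD[OF assms(1)] q(3) by auto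
  then show ?thesis using that i i' q q' by blast
qed

lemma fibrant_fib:
  assumes "fibrant M Y" "q \<in> hom M Z Y" "q \<in> fib M"
  shows "fibrant M Z"
proof -
  obtain t where t: "t \<in> fib M" "dom M t = Y" "terminal M (cod M t)"
    using assms(1) unfolding fibrant_def by blast
  then have th: "t \<in> hom M Y (cod M t)" using classes by (auto simp: hom_def)
  have "t \<cdot> q \<in> fib M" using fib_comp[OF assms(2,3) th t(1)] .
  then show ?thesis
    unfolding fibrant_def using homD[OF cmp_in[OF assms(2) th]] t(3) by metis
qed

text \<open>The retraction is a lift of the identity of \<open>X\<close> against \<open>X \<rightarrow> 1\<close>.\<close>

lemma trivial_cofib_retraction:
  assumes X: "fibrant M X" and j: "j \<in> hom M X Z" "j \<in> cofib M" "j \<in> weq M"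
  obtains r where "r \<in> hom M Z X" "r \<cdot> j = ident M X" "r \<in> weq M"
proof -
  obtain t T where t: "t \<in> fib M" "t \<in> hom M X T" "terminal M T"
    using X classes unfolding fibrant_def by (metis (no_types) arr_hom subsetD)
  have id: "ident M X \<in> hom M X X" using ident_in homD[OF j(1)] by blast
  obtain v where v: "v \<in> hom M Z T"
    using t(3) homD[OF j(1)] unfolding terminal_def by metis
  have "t \<cdot> ident M X = v \<cdot> j"
    using cmp_in[OF id t(2)] cmp_in[OF j(1) v] t(3) homD[OF j(1)] unfolding terminal_def by metis
  moreover have "has_lift M j t" using lifting(1) j t(1) by blast
  ultimately obtain r where r: "r \<in> hom M Z X" "r \<cdot> j = ident M X"
    using has_liftD[OF _ j(1) t(2) id v] by metis
  \<comment> \<open>Two-out-of-three for \<open>j \<cdot> ident = j\<close>.\<close>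
  have "ident M X \<in> weq M"
    using two_of_three(3)[OF id j(1)] ident_right[OF j(1)] j(3) by simp
  then have "r \<in> weq M" using two_of_three(2)[OF j(1) r(1) j(3)] r(2) by simp
  with r show ?thesis using that by blast
qed

section \<open>Maps out of pushouts\<close>

lemma po_is_pushout:
  assumes "f \<in> hom M a b" "g \<in> hom M a c"
  shows "is_pushout M f g (po_inl M f g) (po_inr M f g)"
proof -
  have "\<exists>x. case x of (i, j) \<Rightarrow> is_pushout M f g i j"
    using pushout_exists[OF finite_colimits assms] by auto
  from someI_ex[OF this] show ?thesis
    by (simp add: po_inl_def po_inr_def split: prod.splits)
qed

lemma po_map_unique:
  assumes f: "f \<in> hom M a b" and g: "g \<in> hom M a c" and u: "u \<in> hom M b Q" and v: "v \<in> hom M c Q"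
    and eq: "u \<cdot> f = v \<cdot> g"
  shows "po_map M f g u v \<in> hom M (cod M (po_inl M f g)) Q"
    and "po_map M f g u v \<cdot> po_inl M f g = u"
    and "po_map M f g u v \<cdot> po_inr M f g = v"
    and "\<And>w. w \<in> hom M (cod M (po_inl M f g)) Q \<Longrightarrow> w \<cdot> po_inl M f g = u \<Longrightarrow>
      w \<cdot> po_inr M f g = v \<Longrightarrow> w = po_map M f g u v"
proof -
  have ex: "\<exists>!w. w \<in> hom M (cod M (po_inl M f g)) Q \<and> w \<cdot> po_inl M f g = u \<and> w \<cdot> po_inr M f g = v"
    using pushoutD(4)[OF po_is_pushout[OF f g] f g u v eq] .
  have cod: "cod M u = Q" using homD[OF u] by blast
  note I = theI'[OF ex]
  show "po_map M f g u v \<in> hom M (cod M (po_inl M f g)) Q"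
    "po_map M f g u v \<cdot> po_inl M f g = u"
    "po_map M f g u v \<cdot> po_inr M f g = v"
    using I unfolding po_map_def cod by auto
  show "w = po_map M f g u v" if "w \<in> hom M (cod M (po_inl M f g)) Q" "w \<cdot> po_inl M f g = u"
      "w \<cdot> po_inr M f g = v" for w
    unfolding po_map_def cod using that by (intro the1_equality[OF ex, symmetric]) auto
qed

lemma po_map_comp:
  assumes f: "f \<in> hom M a b" and g: "g \<in> hom M a c" and u: "u \<in> hom M b Q" and v: "v \<in> hom M c Q"
    and eq: "u \<cdot> f = v \<cdot> g" and t: "t \<in> hom M Q R"
  shows "po_map M f g (t \<cdot> u) (t \<cdot> v) = t \<cdot> po_map M f g u v"
proof -
  note po = pushoutD[OF po_is_pushout[OF f g] f g]
  note w = po_map_unique(1-3)[OF f g u v eq]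
  have "(t \<cdot> u) \<cdot> f = (t \<cdot> v) \<cdot> g"
    using assoc[OF f u t] assoc[OF g v t] eq by simp
  from po_map_unique(4)[OF f g cmp_in[OF u t] cmp_in[OF v t] this cmp_in[OF w(1) t]]
  show ?thesis
    using assoc[OF po(1) w(1) t] assoc[OF po(2) w(1) t] w(2,3) by simp
qed

text \<open>For a map \<open>h\<close> from \<open>e\<close> to \<open>h \<cdot> e\<close> in the undercategory of \<open>a\<close>, the map \<open>b \<amalg>\<^sub>a k \<rightarrow> x\<close> factors
  through \<open>c \<amalg>\<^sub>a k\<close>.  Two-out-of-three then compares the condition on deformations for \<open>e\<close> and
  \<open>h \<cdot> e\<close>.\<close>

lemma po_map_cobase_map:
  assumes e: "e \<in> hom M a b" and p: "p \<in> hom M a k" and h: "h \<in> hom M b c"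
    and m: "m \<in> hom M c x" and f: "f \<in> hom M k x" and eq: "m \<cdot> (h \<cdot> e) = f \<cdot> p"
  shows "cobase_map M p e h \<in> hom M (cod M (po_inl M e p)) (cod M (po_inl M (h \<cdot> e) p))"
    and "po_map M e p (m \<cdot> h) f = po_map M (h \<cdot> e) p m f \<cdot> cobase_map M p e h"
proof -
  have he: "h \<cdot> e \<in> hom M a c" using cmp_in[OF e h] .
  note po = pushoutD[OF po_is_pushout[OF e p] e p]
  note po' = pushoutD[OF po_is_pushout[OF he p] he p]
  note w' = po_map_unique[OF he p m f eq]
  have "(po_inl M (h \<cdot> e) p \<cdot> h) \<cdot> e = po_inr M (h \<cdot> e) p \<cdot> p"
    using assoc[OF e h po'(1)] po'(3) by simp
  note w = po_map_unique[OF e p cmp_in[OF h po'(1)] po'(2) this, folded cobase_map_def]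
  show "cobase_map M p e h \<in> hom M (cod M (po_inl M e p)) (cod M (po_inl M (h \<cdot> e) p))"
    by (rule w(1))
  have "(m \<cdot> h) \<cdot> e = f \<cdot> p" using assoc[OF e h m] eq by simp
  from po_map_unique(4)[OF e p cmp_in[OF h m] f this cmp_in[OF w(1) w'(1)]]
  show "po_map M e p (m \<cdot> h) f = po_map M (h \<cdot> e) p m f \<cdot> cobase_map M p e h"
    using assoc[OF po(1) w(1) w'(1)] assoc[OF po(2) w(1) w'(1)] w(2,3) w'(2,3)
      assoc[OF h po'(1) w'(1)] by simp
qed

end

section \<open>Deformations and their equivalence\<close>

definition post :: "('o, 'm, 'z) precat_scheme \<Rightarrow> 'm \<Rightarrow> 'm \<times> 'm \<Rightarrow> 'm \<times> 'm" where
  "post M t = (\<lambda>(g, m). (g, t \<cdot>\<^bsub>M\<^esub> m))"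

lemma post_pair [simp]: "post M t (g, m) = (g, t \<cdot>\<^bsub>M\<^esub> m)"
  by (simp add: post_def)

lemma equiv_def_equiv: "equiv (deformations M f p) (def_equiv M f p)"
proof (rule equivI)
  let ?S = "direct_equiv M f p \<union> (direct_equiv M f p)\<inverse>"
  show "def_equiv M f p \<subseteq> deformations M f p \<times> deformations M f p"
    "refl_on (deformations M f p) (def_equiv M f p)"
    by (auto simp: def_equiv_def refl_on_def)
  have "sym (?S\<^sup>*)" by (intro sym_rtrancl sym_Un_converse)
  then show "sym (def_equiv M f p)"
    unfolding def_equiv_def by (auto simp: sym_def)
  show "trans (def_equiv M f p)"
    unfolding def_equiv_def by (auto simp: trans_def intro: rtrancl_trans)
qed

lemma def_equiv_refl: "D \<in> deformations M f p \<Longrightarrow> (D, D) \<in> def_equiv M f p"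
  using equiv_def_equiv[of M f p] by (meson equivE refl_onD)

lemma def_equiv_sym: "(D, E) \<in> def_equiv M f p \<Longrightarrow> (E, D) \<in> def_equiv M f p"
  using equiv_def_equiv[of M f p] by (meson equivE symD)

lemma def_equiv_trans:
  "(D, E) \<in> def_equiv M f p \<Longrightarrow> (E, F) \<in> def_equiv M f p \<Longrightarrow> (D, F) \<in> def_equiv M f p"
  using equiv_def_equiv[of M f p] by (meson equivE transD)

lemma direct_equivI:
  assumes "(g, n) \<in> deformations M f p" and "(g', m) \<in> deformations M f p"
    and "h \<in> hom M (cod M g) (cod M g')" and "h \<cdot>\<^bsub>M\<^esub> g = g'" and "m \<cdot>\<^bsub>M\<^esub> h = n"
  shows "((g, n), (g', m)) \<in> direct_equiv M f p"
  unfolding direct_equiv_def using assms by blast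

lemma direct_equiv_deformations:
  "(D, E) \<in> direct_equiv M f p \<Longrightarrow> D \<in> deformations M f p \<and> E \<in> deformations M f p"
  by (auto simp: direct_equiv_def)

lemma def_equiv_deformations:
  "(D, E) \<in> def_equiv M f p \<Longrightarrow> D \<in> deformations M f p \<and> E \<in> deformations M f p"
  by (auto simp: def_equiv_def)

lemma direct_equiv_imp_def_equiv: "(D, E) \<in> direct_equiv M f p \<Longrightarrow> (D, E) \<in> def_equiv M f p"
  using direct_equiv_deformations[of D E M f p] by (auto simp: def_equiv_def)

lemma def_equiv_induct [consumes 1, case_names refl forward backward]:
  assumes "(D, E) \<in> def_equiv M f p" and "P D"
    and "\<And>F G. (F, G) \<in> direct_equiv M f p \<Longrightarrow> P F \<Longrightarrow> P G"
    and "\<And>F G. (F, G) \<in> direct_equiv M f p \<Longrightarrow> P G \<Longrightarrow> P F"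
  shows "P E"
proof -
  have "(D, E) \<in> (direct_equiv M f p \<union> (direct_equiv M f p)\<inverse>)\<^sup>*"
    using assms(1) by (simp add: def_equiv_def)
  then show ?thesis
    by (induction rule: rtrancl_induct) (use assms(2-4) in auto)
qed

lemma MK_objD:
  assumes "p \<in> MK_obj M K" and "flat M e" "dom M e = dom M p"
    and "h \<in> arr M" "dom M h = cod M e" "flat M (h \<cdot>\<^bsub>M\<^esub> e)"
  shows "h \<in> weq M \<longleftrightarrow> cobase_map M p e h \<in> weq M"
  using assms unfolding MK_obj_def by simp

locale flat_cofibrations = model_category M
  for M :: "('o, 'm, 'z) model_cat_scheme" (structure) +
  fixes K :: 'o and p :: 'm
  assumes cofib_flat: "i \<in> cofib M \<Longrightarrow> flat M i"
    and base: "p \<in> MK_obj M K"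
begin

lemma base_hom: "p \<in> hom M (dom M p) K"
  using base by (simp add: MK_obj_def hom_def)

lemma deformations_iff:
  assumes "f \<in> hom M K X"
  shows "(g, m) \<in> deformations M f p \<longleftrightarrow> flat M g \<and> g \<in> hom M (dom M p) (cod M g) \<and>
    m \<in> hom M (cod M g) X \<and> m \<cdot> g = f \<cdot> p \<and> po_map M g p m f \<in> weq M"
  using homD[OF assms] by (auto simp: deformations_def hom_def flat_def)

text \<open>Membership of \<open>p : A \<rightarrow> K\<close> in \<open>M(K)\<close> turns the weak equivalence \<open>h\<close> between flat objects
  under \<open>A\<close> into a weak equivalence between their pushouts to \<open>K\<close>, and the maps from these
  pushouts to \<open>X\<close> form a commutative triangle with it.\<close>

lemma deformations_along_weq:
  assumes f: "f \<in> hom M K X" and e: "e \<in> hom M (dom M p) W" and h: "h \<in> hom M W V"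
    and m: "m \<in> hom M V X" and eq: "m \<cdot> (h \<cdot> e) = f \<cdot> p"
    and flat: "flat M e" "flat M (h \<cdot> e)" and weq: "h \<in> weq M"
  shows "(e, m \<cdot> h) \<in> deformations M f p \<longleftrightarrow> (h \<cdot> e, m) \<in> deformations M f p"
proof -
  note he = cmp_in[OF e h]
  have dc: "cod M e = W" "cod M (h \<cdot> e) = V" using homD[OF e] homD[OF he] by auto
  have eq': "(m \<cdot> h) \<cdot> e = f \<cdot> p" using assoc[OF e h m] eq by simp
  note c = po_map_cobase_map[OF e base_hom h m f eq]
  have "cobase_map M p e h \<in> weq M"
    using MK_objD[OF base flat(1) _ _ _ flat(2)] weq homD[OF h] homD[OF e] by simp
  then have "po_map M e p (m \<cdot> h) f \<in> weq M \<longleftrightarrow> po_map M (h \<cdot> e) p m f \<in> weq M"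
    using two_of_three(1,2)[OF c(1) po_map_unique(1)[OF he base_hom m f eq]] c(2) by metis
  then show ?thesis
    unfolding deformations_iff[OF f] dc using flat e he m cmp_in[OF h m] eq eq' by blast
qed

text \<open>The map \<open>X\<^sub>A \<amalg>\<^sub>A K \<rightarrow> Y\<close> is the composite of \<open>X\<^sub>A \<amalg>\<^sub>A K \<rightarrow> X\<close> and the weak equivalence
  \<open>t\<close>.\<close>

lemma post_deformations_iff:
  assumes f: "f \<in> hom M K X" and t: "t \<in> hom M X Y" "t \<in> weq M"
    and g: "g \<in> hom M (dom M p) W" and m: "m \<in> hom M W X" and eq: "m \<cdot> g = f \<cdot> p"
  shows "(g, t \<cdot> m) \<in> deformations M (t \<cdot> f) p \<longleftrightarrow> (g, m) \<in> deformations M f p"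
proof -
  have dc: "cod M g = W" using homD[OF g] by auto
  have "(t \<cdot> m) \<cdot> g = (t \<cdot> f) \<cdot> p"
    using assoc[OF g m t(1)] assoc[OF base_hom f t(1)] eq by simp
  moreover have "po_map M g p (t \<cdot> m) (t \<cdot> f) \<in> weq M \<longleftrightarrow> po_map M g p m f \<in> weq M"
    unfolding po_map_comp[OF g base_hom m f eq t(1)]
    using two_of_three(1,3)[OF po_map_unique(1)[OF g base_hom m f eq] t(1)] t(2) by blast
  ultimately show ?thesis
    unfolding deformations_iff[OF f] deformations_iff[OF cmp_in[OF f t(1)]] dc
    using g m eq cmp_in[OF m t(1)] by blast
qed

lemma post_deformation:
  assumes "f \<in> hom M K X" "t \<in> hom M X Y" "t \<in> weq M" "D \<in> deformations M f p"
  shows "post M t D \<in> deformations M (t \<cdot> f) p"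
  using post_deformations_iff[OF assms(1-3)] assms(4) deformations_iff[OF assms(1)]
  by (cases D) auto

lemma post_post:
  assumes f: "f \<in> hom M K X" and t: "t \<in> hom M X Y" and s: "s \<in> hom M Y Z"
    and D: "D \<in> deformations M f p"
  shows "post M s (post M t D) = post M (s \<cdot> t) D"
proof (cases D)
  case (Pair g m)
  then have "m \<in> hom M (cod M g) X" using D deformations_iff[OF f] by simp
  from assoc[OF this t s] show ?thesis using Pair by simp
qed

lemma post_ident:
  assumes f: "f \<in> hom M K X" and D: "D \<in> deformations M f p"
  shows "post M (ident M X) D = D"
proof (cases D)
  case (Pair g m)
  then have "m \<in> hom M (cod M g) X" using D deformations_iff[OF f] by simp
  from ident_left[OF this] show ?thesis using Pair by simp
qed

lemma post_direct_equiv: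
  assumes f: "f \<in> hom M K X" and t: "t \<in> hom M X Y" "t \<in> weq M"
    and DE: "(D, E) \<in> direct_equiv M f p"
  shows "(post M t D, post M t E) \<in> direct_equiv M (t \<cdot> f) p"
proof -
  obtain g n g' m h where D: "D = (g, n)" and E: "E = (g', m)"
    and h: "h \<in> hom M (cod M g) (cod M g')" "h \<cdot> g = g'" "m \<cdot> h = n"
    using DE by (auto simp: direct_equiv_def)
  have def: "D \<in> deformations M f p" "E \<in> deformations M f p"
    using direct_equiv_deformations[OF DE] by auto
  then have "m \<in> hom M (cod M g') X" using deformations_iff[OF f] E by simp
  from assoc[OF h(1) this t(1)] show ?thesis
    using post_deformation[OF f t def(1)] post_deformation[OF f t def(2)] h
    by (auto simp: D E direct_equiv_def)
qed

lemma post_def_equiv: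
  assumes f: "f \<in> hom M K X" and t: "t \<in> hom M X Y" "t \<in> weq M"
    and DE: "(D, E) \<in> def_equiv M f p"
  shows "(post M t D, post M t E) \<in> def_equiv M (t \<cdot> f) p"
  using DE
proof (induction rule: def_equiv_induct)
  case refl
  show ?case
    using def_equiv_refl[OF post_deformation[OF f t]] def_equiv_deformations[OF DE] by blast
next
  case (forward F G)
  show ?case
    by (rule def_equiv_trans[OF forward(2)])
      (rule direct_equiv_imp_def_equiv[OF post_direct_equiv[OF f t forward(1)]])
next
  case (backward F G)
  show ?case
    by (rule def_equiv_trans[OF backward(2)], rule def_equiv_sym)
      (rule direct_equiv_imp_def_equiv[OF post_direct_equiv[OF f t backward(1)]])
qed

definition reflects :: "'m \<Rightarrow> 'm \<Rightarrow> bool" where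
  "reflects f t \<longleftrightarrow> (\<forall>E \<in> deformations M f p. \<forall>F \<in> deformations M f p.
    (post M t E, post M t F) \<in> def_equiv M (t \<cdot> f) p \<longrightarrow> (E, F) \<in> def_equiv M f p)"

definition ess_surj :: "'m \<Rightarrow> 'm \<Rightarrow> bool" where
  "ess_surj f t \<longleftrightarrow> (\<forall>D \<in> deformations M (t \<cdot> f) p. \<exists>E \<in> deformations M f p.
    (post M t E, D) \<in> def_equiv M (t \<cdot> f) p)"

lemma bij_betw_Def_map:
  assumes f: "f \<in> hom M K X" and t: "t \<in> hom M X Y" "t \<in> weq M"
    and refl: "reflects f t" and surj: "ess_surj f t"
  shows "bij_betw (Def_map M t f p) (Def M f p) (Def M (t \<cdot> f) p)"
proof -
  let ?R = "def_equiv M f p" and ?S = "def_equiv M (t \<cdot> f) p"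
  note R = equiv_def_equiv[of M f p] and S = equiv_def_equiv[of M "t \<cdot> f" p]
  have map: "Def_map M t f p (?R `` {E}) = ?S `` {post M t E}" if E: "E \<in> deformations M f p" for E
  proof -
    have "?S `` {post M t F} = ?S `` {post M t E}" if "F \<in> ?R `` {E}" for F
      using equiv_class_eq[OF S post_def_equiv[OF f t]] that by blast
    moreover have "E \<in> ?R `` {E}" using def_equiv_refl[OF E] by blast
    ultimately have "(\<Union>F \<in> ?R `` {E}. ?S `` {post M t F}) = ?S `` {post M t E}" by blast
    then show ?thesis unfolding Def_map_def post_def by (simp add: case_prod_unfold)
  qed
  show ?thesis
    unfolding bij_betw_def
  proof
    show "inj_on (Def_map M t f p) (Def M f p)"
    proof (rule inj_onI)
      fix c d assume c: "c \<in> Def M f p" and d: "d \<in> Def M f p"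
        and eq: "Def_map M t f p c = Def_map M t f p d"
      obtain E F where E: "c = ?R `` {E}" "E \<in> deformations M f p"
        and F: "d = ?R `` {F}" "F \<in> deformations M f p"
        using c d unfolding Def_def by (meson quotientE)
      have "?S `` {post M t E} = ?S `` {post M t F}" using eq map E F by simp
      then have "(post M t E, post M t F) \<in> ?S"
        using eq_equiv_class[OF _ S] post_deformation[OF f t F(2)] by blast
      then have "(E, F) \<in> ?R" using refl E(2) F(2) unfolding reflects_def by blast
      then show "c = d" using equiv_class_eq[OF R] E F by simp
    qed
    show "Def_map M t f p ` Def M f p = Def M (t \<cdot> f) p"
    proof
      show "Def_map M t f p ` Def M f p \<subseteq> Def M (t \<cdot> f) p"
        unfolding Def_def using map post_deformation[OF f t]
        by (auto elim!: quotientE intro!: quotientI)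
      show "Def M (t \<cdot> f) p \<subseteq> Def_map M t f p ` Def M f p"
      proof
        fix d assume "d \<in> Def M (t \<cdot> f) p"
        then obtain D where D: "d = ?S `` {D}" "D \<in> deformations M (t \<cdot> f) p"
          unfolding Def_def by (meson quotientE)
        then obtain E where E: "E \<in> deformations M f p" "(post M t E, D) \<in> ?S"
          using surj unfolding ess_surj_def by blast
        then have "d = Def_map M t f p (?R `` {E})"
          using map equiv_class_eq[OF S] D by simp
        then show "d \<in> Def_map M t f p ` Def M f p"
          unfolding Def_def using E(1) by (blast intro: quotientI)
      qed
    qed
  qed
qed

section \<open>Trivial fibrations\<close>

text \<open>Here \<open>D = (A \<rightarrow> Y\<^sub>A, Y\<^sub>A \<rightarrow> Y)\<close>, and \<open>E\<close> is obtained from the fibre product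
  \<open>Y\<^sub>A \<times>\<^sub>Y X\<close> (with projections \<open>a\<close>, \<open>b\<close>) by factoring \<open>A \<rightarrow> Y\<^sub>A \<times>\<^sub>Y X\<close> into a cofibration and a
  trivial fibration \<open>s\<close>.  The map from \<open>A\<close> to the fibre product need not be flat, whereas the
  cofibration is; it also has the lifting property that makes \<open>E\<close>
  independent of choices up to equivalence.\<close>

definition pulled_back :: "'m \<Rightarrow> 'm \<Rightarrow> 'm \<times> 'm \<Rightarrow> 'm \<times> 'm \<Rightarrow> bool" where
  "pulled_back f t D E \<longleftrightarrow> (\<exists>a b s. is_pullback M (snd D) t a b \<and>
    fst E \<in> cofib M \<and> fst E \<in> hom M (dom M p) (dom M s) \<and>
    s \<in> fib M \<inter> weq M \<and> s \<in> hom M (dom M s) (dom M a) \<and>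
    a \<cdot> (s \<cdot> fst E) = fst D \<and> b \<cdot> (s \<cdot> fst E) = f \<cdot> p \<and> snd E = b \<cdot> s)"

lemma pulled_back_exists:
  assumes f: "f \<in> hom M K X" and t: "t \<in> hom M X Y" and D: "D \<in> deformations M (t \<cdot> f) p"
  shows "\<exists>E. pulled_back f t D E"
proof -
  obtain y n where yn: "D = (y, n)" by (cases D)
  have y: "y \<in> hom M (dom M p) (cod M y)" and n: "n \<in> hom M (cod M y) Y"
    and eq: "n \<cdot> y = (t \<cdot> f) \<cdot> p"
    using D deformations_iff[OF cmp_in[OF f t]] yn by auto
  obtain a b where pb: "is_pullback M n t a b"
    using pullback_exists[OF finite_limits n t] by blast
  note pbD = pullbackD[OF pb n t]
  have "n \<cdot> y = t \<cdot> (f \<cdot> p)" using eq assoc[OF base_hom f t] by simp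
  then obtain z where z: "z \<in> hom M (dom M p) (dom M a)" "a \<cdot> z = y" "b \<cdot> z = f \<cdot> p"
    using pbD(4)[OF y cmp_in[OF base_hom f]] by blast
  obtain w s W where w: "w \<in> hom M (dom M p) W" "w \<in> cofib M"
    and s: "s \<in> hom M W (dom M a)" "s \<in> fib M \<inter> weq M" "s \<cdot> w = z"
    using cofib_fact[OF z(1)] by metis
  have "dom M s = W" using homD[OF s(1)] by auto
  then have "pulled_back f t D (w, b \<cdot> s)"
    unfolding pulled_back_def using pb w s z yn by (intro exI[of _ a] exI[of _ b] exI[of _ s]) simp
  then show ?thesis by blast
qed

text \<open>The composite \<open>a \<cdot> s\<close> to \<open>Y\<^sub>A\<close> is a weak equivalence, because \<open>a\<close> is a pullback of the
  trivial fibration \<open>t\<close>.\<close>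

lemma pulled_back_over:
  assumes f: "f \<in> hom M K X" and t: "t \<in> hom M X Y" and tf: "t \<in> fib M \<inter> weq M"
    and D: "D \<in> deformations M (t \<cdot> f) p" and pb: "pulled_back f t D E"
  shows "E \<in> deformations M f p" "(post M t E, D) \<in> direct_equiv M (t \<cdot> f) p"
    and "fst E \<in> cofib M"
proof -
  obtain y n where yn: "D = (y, n)" by (cases D)
  obtain w m where wm: "E = (w, m)" by (cases E)
  have n: "n \<in> hom M (cod M y) Y" using D deformations_iff[OF cmp_in[OF f t]] yn by auto
  obtain a b s W where A: "is_pullback M n t a b" "w \<in> cofib M" "w \<in> hom M (dom M p) W"
    "s \<in> fib M \<inter> weq M" "s \<in> hom M W (dom M a)" "a \<cdot> (s \<cdot> w) = y" "b \<cdot> (s \<cdot> w) = f \<cdot> p" "m = b \<cdot> s"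
    using pb unfolding pulled_back_def yn wm fst_conv snd_conv by blast
  note P = pullbackD[OF A(1) n t]
  have y: "flat M y" "n \<cdot> y = (t \<cdot> f) \<cdot> p"
    using D deformations_iff[OF cmp_in[OF f t]] yn by auto
  define h where "h = a \<cdot> s"
  have h: "h \<in> hom M W (cod M y)" "h \<in> weq M" "h \<cdot> w = y" "n \<cdot> h = t \<cdot> m"
    unfolding h_def A(8)
    using cmp_in[OF A(5) P(1)] two_of_three(1)[OF A(5) P(1)] A(4) trivial_fib_pullback[OF A(1) n t tf]
      assoc[OF A(3,5) P(1)] A(6) assoc[OF A(5) P(1) n] assoc[OF A(5) P(2) t] P(3) by auto
  have tm: "(w, t \<cdot> m) \<in> deformations M (t \<cdot> f) p"
    using deformations_along_weq[OF cmp_in[OF f t] A(3) h(1) n _ cofib_flat[OF A(2)] _ h(2)]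
      h(3,4) y D yn by simp
  moreover have "m \<in> hom M W X" "m \<cdot> w = f \<cdot> p"
    unfolding A(8) using cmp_in[OF A(5) P(2)] assoc[OF A(3,5) P(2)] A(7) by auto
  ultimately show "E \<in> deformations M f p"
    using post_deformations_iff[OF f t _ A(3)] tf wm by simp
  have "cod M w = W" using homD[OF A(3)] by auto
  then show "(post M t E, D) \<in> direct_equiv M (t \<cdot> f) p"
    using tm D h unfolding direct_equiv_def yn wm by auto
  show "fst E \<in> cofib M" using A(2) wm by simp
qed

text \<open>The pair of maps to \<open>Y\<^sub>A\<close> and \<open>X\<close> gives a map to the fibre product, which lifts along \<open>s\<close>
  relative to \<open>A\<close> because \<open>g\<close> is a cofibration.\<close>

lemma cofibrant_maps_to_pulled_back:
  assumes f: "f \<in> hom M K X" and t: "t \<in> hom M X Y" and tf: "t \<in> fib M \<inter> weq M"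
    and D: "(y, n) \<in> deformations M (t \<cdot> f) p" and pb: "pulled_back f t (y, n) E"
    and F: "(g, m) \<in> deformations M f p" and g: "g \<in> cofib M"
    and h: "h \<in> hom M (cod M g) (cod M y)" "h \<cdot> g = y" "n \<cdot> h = t \<cdot> m"
  shows "((g, m), E) \<in> direct_equiv M f p"
proof -
  obtain w m' where wm: "E = (w, m')" by (cases E)
  have n: "n \<in> hom M (cod M y) Y" and y: "y \<in> hom M (dom M p) (cod M y)" "n \<cdot> y = (t \<cdot> f) \<cdot> p"
    using D deformations_iff[OF cmp_in[OF f t]] by auto
  obtain a b s W where A: "is_pullback M n t a b" "w \<in> hom M (dom M p) W"
    "s \<in> fib M \<inter> weq M" "s \<in> hom M W (dom M a)" "a \<cdot> (s \<cdot> w) = y" "b \<cdot> (s \<cdot> w) = f \<cdot> p" "m' = b \<cdot> s"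
    using pb unfolding pulled_back_def wm fst_conv snd_conv by blast
  note P = pullbackD[OF A(1) n t]
  have gm: "g \<in> hom M (dom M p) (cod M g)" "m \<in> hom M (cod M g) X" "m \<cdot> g = f \<cdot> p"
    using F deformations_iff[OF f] by auto
  obtain k where k: "k \<in> hom M (cod M g) (dom M a)" "a \<cdot> k = h" "b \<cdot> k = m"
    using P(4)[OF h(1) gm(2) h(3)] by blast
  have "a \<cdot> (k \<cdot> g) = y" "b \<cdot> (k \<cdot> g) = f \<cdot> p"
    using assoc[OF gm(1) k(1) P(1)] assoc[OF gm(1) k(1) P(2)] k h gm(3) by auto
  moreover have "n \<cdot> y = t \<cdot> (f \<cdot> p)" using y assoc[OF base_hom f t] by simp
  ultimately have "s \<cdot> w = k \<cdot> g"
    using P(4)[OF y(1) cmp_in[OF base_hom f]] cmp_in[OF gm(1) k(1)] cmp_in[OF A(2,4)] A(5,6)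
    by blast
  then obtain l where l: "l \<in> hom M (cod M g) W" "l \<cdot> g = w" "s \<cdot> l = k"
    using has_liftD[OF lifting(2)[OF g A(3)] gm(1) A(4) A(2) k(1)] by blast
  have "m' \<cdot> l = m" using A(7) assoc[OF l(1) A(4) P(2)] l(3) k(3) by simp
  moreover have "E \<in> deformations M f p" by (rule pulled_back_over(1)[OF f t tf D pb])
  moreover have "cod M w = W" using homD[OF A(2)] by auto
  ultimately show ?thesis using direct_equivI[OF F] l(1,2) wm by simp
qed

lemma cofibrant_replacement:
  assumes f: "f \<in> hom M K X" and F: "F \<in> deformations M f p"
  obtains V where "(V, F) \<in> direct_equiv M f p" "fst V \<in> cofib M"
proof -
  obtain g m where gm: "F = (g, m)" by (cases F)
  have g: "g \<in> hom M (dom M p) (cod M g)" "m \<in> hom M (cod M g) X" "m \<cdot> g = f \<cdot> p" "flat M g"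
    using F deformations_iff[OF f] gm by auto
  obtain i q W where i: "i \<in> hom M (dom M p) W" "i \<in> cofib M"
    and q: "q \<in> hom M W (cod M g)" "q \<in> fib M \<inter> weq M" "q \<cdot> i = g"
    using cofib_fact[OF g(1)] by blast
  have "(i, m \<cdot> q) \<in> deformations M f p"
    using deformations_along_weq[OF f i(1) q(1) g(2) _ cofib_flat[OF i(2)]] q(2,3) g(3,4) F gm
    by simp
  moreover have "cod M i = W" using homD[OF i(1)] by auto
  ultimately have "((i, m \<cdot> q), F) \<in> direct_equiv M f p"
    using F q unfolding direct_equiv_def gm by auto
  with that i(2) show ?thesis by simp
qed

text \<open>A cofibrant replacement of \<open>F\<close> maps both to \<open>F\<close> and, since its maps to \<open>F\<close> and to \<open>X\<close> agree
  in \<open>Y\<close>, to \<open>E\<close>.\<close>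

lemma pulled_back_post:
  assumes f: "f \<in> hom M K X" and t: "t \<in> hom M X Y" and tf: "t \<in> fib M \<inter> weq M"
    and F: "F \<in> deformations M f p" and pb: "pulled_back f t (post M t F) E"
  shows "(F, E) \<in> def_equiv M f p"
proof -
  obtain V where V: "(V, F) \<in> direct_equiv M f p" "fst V \<in> cofib M"
    using cofibrant_replacement[OF f F] .
  obtain g m where gm: "F = (g, m)" by (cases F)
  obtain v k h where vk: "V = (v, k)" "h \<in> hom M (cod M v) (cod M g)" "h \<cdot> v = g" "m \<cdot> h = k"
    using V(1) unfolding direct_equiv_def gm by auto
  have m: "m \<in> hom M (cod M g) X" using F deformations_iff[OF f] gm by auto
  have "(v, k) \<in> deformations M f p" using direct_equiv_deformations[OF V(1)] vk(1) by simp
  moreover have "(g, t \<cdot> m) \<in> deformations M (t \<cdot> f) p"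
    using post_deformation[OF f t _ F] tf gm by simp
  ultimately have "(V, E) \<in> direct_equiv M f p"
    using cofibrant_maps_to_pulled_back[OF f t tf, of g "t \<cdot> m" E v k h] pb V(2) vk gm
      assoc[OF vk(2) m t] by simp
  with V(1) show ?thesis
    using direct_equiv_imp_def_equiv def_equiv_sym def_equiv_trans by metis
qed

lemma pulled_back_direct_equiv:
  assumes f: "f \<in> hom M K X" and t: "t \<in> hom M X Y" and tf: "t \<in> fib M \<inter> weq M"
    and DD: "(D, D') \<in> direct_equiv M (t \<cdot> f) p"
    and pb: "pulled_back f t D E" "pulled_back f t D' E'"
  shows "(E, E') \<in> direct_equiv M f p"
proof -
  have def: "D \<in> deformations M (t \<cdot> f) p" "D' \<in> deformations M (t \<cdot> f) p"
    using direct_equiv_deformations[OF DD] by auto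
  obtain y n y' n' w m where yn: "D = (y, n)" "D' = (y', n')" "E = (w, m)"
    by (cases D, cases D', cases E)
  note over = pulled_back_over[OF f t tf def(1) pb(1)]
  obtain h where h: "h \<in> hom M (cod M w) (cod M y)" "h \<cdot> w = y" "n \<cdot> h = t \<cdot> m"
    using over(2) unfolding direct_equiv_def yn by auto
  obtain e where e: "e \<in> hom M (cod M y) (cod M y')" "e \<cdot> y = y'" "n' \<cdot> e = n"
    using DD unfolding direct_equiv_def yn by auto
  have w: "w \<in> hom M (dom M p) (cod M w)" using over(1) deformations_iff[OF f] yn by auto
  have n': "n' \<in> hom M (cod M y') Y" using def(2) deformations_iff[OF cmp_in[OF f t]] yn by auto
  show ?thesis
    using cofibrant_maps_to_pulled_back[OF f t tf, of y' n' E' w m "e \<cdot> h"] def(2) pb(2) over(1,3)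
      cmp_in[OF h(1) e(1)] assoc[OF w h(1) e(1)] assoc[OF h(1) e(1) n'] h e yn by simp
qed

lemma trivial_fib_ess_surj:
  assumes f: "f \<in> hom M K X" and t: "t \<in> hom M X Y" and tf: "t \<in> fib M \<inter> weq M"
  shows "ess_surj f t"
  unfolding ess_surj_def
proof
  fix D assume D: "D \<in> deformations M (t \<cdot> f) p"
  then obtain E where "pulled_back f t D E" using pulled_back_exists[OF f t] by blast
  note over = pulled_back_over[OF f t tf D this]
  show "\<exists>E \<in> deformations M f p. (post M t E, D) \<in> def_equiv M (t \<cdot> f) p"
    using over(1) direct_equiv_imp_def_equiv[OF over(2)] by (rule bexI[rotated])
qed

lemma trivial_fib_reflects:
  assumes f: "f \<in> hom M K X" and t: "t \<in> hom M X Y" and tf: "t \<in> fib M \<inter> weq M"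
  shows "reflects f t"
  unfolding reflects_def
proof (intro ballI impI)
  fix F F' assume F: "F \<in> deformations M f p" and F': "F' \<in> deformations M f p"
    and FF: "(post M t F, post M t F') \<in> def_equiv M (t \<cdot> f) p"
  \<comment> \<open>The invariant along the zigzag: everything pulled back from the current deformation of
    \<open>t \<cdot> f\<close> is equivalent to \<open>F\<close>.\<close>
  have "\<forall>E. pulled_back f t (post M t F') E \<longrightarrow> (F, E) \<in> def_equiv M f p"
    using FF
  proof (induction rule: def_equiv_induct)
    case refl
    show ?case using pulled_back_post[OF f t tf F] by blast
  next
    case (forward D D')
    obtain E where E: "pulled_back f t D E"
      using pulled_back_exists[OF f t] direct_equiv_deformations[OF forward(1)] by metis
    show ?case
    proof (intro allI impI)
      fix E' assume "pulled_back f t D' E'"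
      note EE' = pulled_back_direct_equiv[OF f t tf forward(1) E this]
      have "(F, E) \<in> def_equiv M f p" using forward(2) E by blast
      from this direct_equiv_imp_def_equiv[OF EE'] show "(F, E') \<in> def_equiv M f p"
        by (rule def_equiv_trans)
    qed
  next
    case (backward D' D)
    obtain E where E: "pulled_back f t D E"
      using pulled_back_exists[OF f t] direct_equiv_deformations[OF backward(1)] by metis
    show ?case
    proof (intro allI impI)
      fix E' assume "pulled_back f t D' E'"
      note EE' = pulled_back_direct_equiv[OF f t tf backward(1) this E]
      have "(F, E) \<in> def_equiv M f p" using backward(2) E by blast
      from this def_equiv_sym[OF direct_equiv_imp_def_equiv[OF EE']]
      show "(F, E') \<in> def_equiv M f p" by (rule def_equiv_trans)
    qed
  qed
  moreover obtain E where E: "pulled_back f t (post M t F') E"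
    using pulled_back_exists[OF f t post_deformation[OF f t _ F']] tf by blast
  ultimately have "(F, E) \<in> def_equiv M f p" by blast
  from this def_equiv_sym[OF pulled_back_post[OF f t tf F' E]]
  show "(F, F') \<in> def_equiv M f p" by (rule def_equiv_trans)
qed

section \<open>Weak equivalences of fibrant objects\<close>

lemma reflects_comp:
  assumes f: "f \<in> hom M K X" and t: "t \<in> hom M X Y" "t \<in> weq M" and s: "s \<in> hom M Y Z"
    and rt: "reflects f t" and rs: "reflects (t \<cdot> f) s"
  shows "reflects f (s \<cdot> t)"
  unfolding reflects_def
proof (intro ballI impI)
  fix E F assume E: "E \<in> deformations M f p" and F: "F \<in> deformations M f p"
    and EF: "(post M (s \<cdot> t) E, post M (s \<cdot> t) F) \<in> def_equiv M ((s \<cdot> t) \<cdot> f) p"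
  have "(post M s (post M t E), post M s (post M t F)) \<in> def_equiv M (s \<cdot> (t \<cdot> f)) p"
    using EF post_post[OF f t(1) s] E F assoc[OF f t(1) s] by simp
  then show "(E, F) \<in> def_equiv M f p"
    using rs rt post_deformation[OF f t] E F unfolding reflects_def by blast
qed

lemma ess_surj_comp:
  assumes f: "f \<in> hom M K X" and t: "t \<in> hom M X Y" "t \<in> weq M"
    and s: "s \<in> hom M Y Z" "s \<in> weq M"
    and et: "ess_surj f t" and es: "ess_surj (t \<cdot> f) s"
  shows "ess_surj f (s \<cdot> t)"
  unfolding ess_surj_def
proof
  fix D assume "D \<in> deformations M ((s \<cdot> t) \<cdot> f) p"
  then have "D \<in> deformations M (s \<cdot> (t \<cdot> f)) p" using assoc[OF f t(1) s(1)] by simp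
  then obtain F where F: "F \<in> deformations M (t \<cdot> f) p"
    "(post M s F, D) \<in> def_equiv M (s \<cdot> (t \<cdot> f)) p"
    using es unfolding ess_surj_def by blast
  then obtain E where E: "E \<in> deformations M f p" "(post M t E, F) \<in> def_equiv M (t \<cdot> f) p"
    using et unfolding ess_surj_def by blast
  have "(post M s (post M t E), D) \<in> def_equiv M (s \<cdot> (t \<cdot> f)) p"
    using post_def_equiv[OF cmp_in[OF f t(1)] s E(2)] F(2) def_equiv_trans by metis
  then have "(post M (s \<cdot> t) E, D) \<in> def_equiv M ((s \<cdot> t) \<cdot> f) p"
    using post_post[OF f t(1) s(1) E(1)] assoc[OF f t(1) s(1)] by simp
  then show "\<exists>E \<in> deformations M f p. (post M (s \<cdot> t) E, D) \<in> def_equiv M ((s \<cdot> t) \<cdot> f) p"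
    using E(1) by blast
qed

text \<open>Applying \<open>r\<close> to an equivalence between \<open>j\<^sub>* E\<close> and \<open>j\<^sub>* F\<close> gives back \<open>E\<close> and \<open>F\<close>.\<close>

lemma section_reflects:
  assumes f: "f \<in> hom M K X" and j: "j \<in> hom M X Z"
    and r: "r \<in> hom M Z X" "r \<in> weq M" "r \<cdot> j = ident M X"
  shows "reflects f j"
  unfolding reflects_def
proof (intro ballI impI)
  fix E F assume E: "E \<in> deformations M f p" and F: "F \<in> deformations M f p"
    and EF: "(post M j E, post M j F) \<in> def_equiv M (j \<cdot> f) p"
  have "r \<cdot> (j \<cdot> f) = f" using assoc[OF f j r(1)] r(3) ident_left[OF f] by simp
  then show "(E, F) \<in> def_equiv M f p"
    using post_def_equiv[OF cmp_in[OF f j] r(1,2) EF] post_post[OF f j r(1)] r(3) post_ident[OF f]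
      E F by simp
qed

text \<open>A preimage of \<open>D\<close> is its image under \<open>r\<close>: the deformations \<open>j\<^sub>* r\<^sub>* D\<close> and \<open>D\<close> have the same image
  under \<open>r\<close>, so they are equivalent.\<close>

lemma section_ess_surj:
  assumes f: "f \<in> hom M K X" and j: "j \<in> hom M X Z" "j \<in> weq M"
    and r: "r \<in> hom M Z X" "r \<in> weq M" "r \<cdot> j = ident M X"
    and rr: "reflects (j \<cdot> f) r"
  shows "ess_surj f j"
  unfolding ess_surj_def
proof
  fix D assume D: "D \<in> deformations M (j \<cdot> f) p"
  have rjf: "r \<cdot> (j \<cdot> f) = f" using assoc[OF f j(1) r(1)] r(3) ident_left[OF f] by simp
  have rD: "post M r D \<in> deformations M f p"
    using post_deformation[OF cmp_in[OF f j(1)] r(1,2) D] rjf by simp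
  then have "post M r (post M j (post M r D)) = post M r D"
    using post_post[OF f j(1) r(1)] r(3) post_ident[OF f] by simp
  then have "(post M j (post M r D), D) \<in> def_equiv M (j \<cdot> f) p"
    using rr D post_deformation[OF f j rD] def_equiv_refl[OF rD] rjf
    unfolding reflects_def by auto
  with rD show "\<exists>E \<in> deformations M f p. (post M j E, D) \<in> def_equiv M (j \<cdot> f) p" by blast
qed

lemma trivial_cofib_reflects:
  assumes "fibrant M X" and f: "f \<in> hom M K X" and j: "j \<in> hom M X Z" "j \<in> cofib M" "j \<in> weq M"
  shows "reflects f j"
  using trivial_cofib_retraction[OF assms(1) j] section_reflects[OF f j(1)] by metis

text \<open>The retraction \<open>r\<close> need not be a fibration, but it is a trivial cofibration \<open>i\<close> out of a fibrant
  object followed by a trivial fibration \<open>q\<close>, and both reflect equivalence.\<close>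

lemma trivial_cofib_ess_surj:
  assumes X: "fibrant M X" and Z: "fibrant M Z"
    and f: "f \<in> hom M K X" and j: "j \<in> hom M X Z" "j \<in> cofib M" "j \<in> weq M"
  shows "ess_surj f j"
proof -
  obtain r where r: "r \<in> hom M Z X" "r \<cdot> j = ident M X" "r \<in> weq M"
    using trivial_cofib_retraction[OF X j] .
  obtain i q V where i: "i \<in> hom M Z V" "i \<in> cofib M" "i \<in> weq M"
    and q: "q \<in> hom M V X" "q \<in> fib M" "q \<in> weq M" "q \<cdot> i = r"
    using weq_fact[OF r(1,3)] .
  note jf = cmp_in[OF f j(1)]
  have "reflects (j \<cdot> f) i" using trivial_cofib_reflects[OF Z jf i] .
  moreover have "reflects (i \<cdot> (j \<cdot> f)) q"
    using trivial_fib_reflects[OF cmp_in[OF jf i(1)] q(1)] q(2,3) by blast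
  ultimately have "reflects (j \<cdot> f) r"
    using reflects_comp[OF jf i(1,3) q(1)] q(4) by simp
  then show ?thesis using section_ess_surj[OF f j(1,3) r(1,3,2)] by blast
qed

theorem weq_fibrant_bij_betw_Def:
  assumes f: "f \<in> hom M K X" and t: "t \<in> hom M X Y" "t \<in> weq M"
    and X: "fibrant M X" and Y: "fibrant M Y"
  shows "bij_betw (Def_map M t f p) (Def M f p) (Def M (t \<cdot> f) p)"
proof -
  obtain j q Z where j: "j \<in> hom M X Z" "j \<in> cofib M" "j \<in> weq M"
    and q: "q \<in> hom M Z Y" "q \<in> fib M" "q \<in> weq M" "q \<cdot> j = t"
    using weq_fact[OF t] .
  note jf = cmp_in[OF f j(1)]
  have Z: "fibrant M Z" using fibrant_fib[OF Y q(1,2)] .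
  have "reflects f t"
    using reflects_comp[OF f j(1,3) q(1) trivial_cofib_reflects[OF X f j]]
      trivial_fib_reflects[OF jf q(1)] q(2-4) by simp
  moreover have "ess_surj f t"
    using ess_surj_comp[OF f j(1,3) q(1,3) trivial_cofib_ess_surj[OF X Z f j]]
      trivial_fib_ess_surj[OF jf q(1)] q(2-4) by simp
  ultimately show ?thesis using bij_betw_Def_map[OF f t] by blast
qed

end

theorem theorem5p3:
  fixes M :: "('o, 'm) model_cat" and K X Y :: 'o and f \<tau> p :: 'm
  assumes "model_category M"
    and "\<And>i. i \<in> cofib M \<Longrightarrow> flat M i"
    and "f \<in> hom M K X"
    and "\<tau> \<in> hom M X Y"
    and "\<tau> \<in> weq M"
    and "fibrant M X"
    and "fibrant M Y"
    and "p \<in> MK_obj M K"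
  shows "bij_betw (Def_map M \<tau> f p) (Def M f p) (Def M (\<tau> \<cdot>\<^bsub>M\<^esub> f) p)"
proof -
  interpret model_category M by fact
  interpret flat_cofibrations M K p
    by unfold_locales (use assms(2,8) in auto)
  show ?thesis
    using weq_fibrant_bij_betw_Def[OF assms(3-7)] .
qed

end
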